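(* Let $X\subset\{0,1\}^{\mathbb{N}}$ be the shift space $X=\overline{\bigcup_{n\ge0}X_n}$ defined in the context. Then $(X,\sigma)$ is $\omega$-chaotic.
   Context: For a dynamical system $(X,T)$ ($X$ compact metric, $T\colon X\to X$ continuous), $\omega_T(x)$ is the set of limit points of the sequence $(T^n(x))_{n\in\mathbb{N}}$. $(X,T)$ is $\omega$-chaotic if there exists an uncountable set $S\subset X$ such that for any $x,y\in S$ with $x\ne y$: $\omega_T(x)\setminus\omega_T(y)$ is uncountable, $\omega_T(x)\cap\omega_T(y)$ is nonempty, and $\omega_T(x)$ is not contained in the set of periodic points. $\mathbb{N}=\{1,2,\dots\}$; $\{0,1\}^{\mathbb{N}}$ carries the product topology and $\sigma$ is the shift map, $\sigma(x)_i=x_{i+1}$. A shift space is a closed $\sigma$-invariant subset. For blocks, $u^\infty=uuu\dots$, $0^\alpha$ is the block of $\alpha$ zeros ($0^0$ is the empty block), and $\|u\|_1$ is the number of $1$'s in $u$. A block is a from-$1$-to-$1$ word if it equals $1$ or has the form $1v1$ with $v\in\{0,1\}^*$ (possibly empty). For a shift space $Y\subset\{0,1\}^{\mathbb{N}}$, $\mathcal{G}_m(Y)$ is the set of all from-$1$-to-$1$ words $u$ that occur in some point of $Y$ and satisfy $\|u\|_1\le m$. Construction of $X$: let $X_0=\{0^\infty\}\cup\{0^\alpha10^\infty:\alpha\ge0\}$. Given $X_n$ ($n\ge0$), let $$P_{n+1}=\bigcup_{l=0}^\infty\sigma^l\big(\{(u0^k)^\infty:k\ge2^{2n},\ u\in\mathcal{G}_{2^n}(X_n)\}\big),$$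 $$J'_{n+1}=\{0^\alpha u0^\infty:\alpha\ge0,\ u\in\mathcal{G}_{2^n}(X_n)\},$$ $$J''_{n+1}=\{0^\alpha u0^\beta v0^\infty:\alpha\ge0,\ \beta\ge2^{2n},\ u,v\in\mathcal{G}_{2^n}(X_n)\},$$ $J_{n+1}=J'_{n+1}\cup J''_{n+1}$, $Y_{n+1}=\overline{P_{n+1}\cup J_{n+1}}$, and $X_{n+1}=X_n\cup Y_{n+1}$. Finally $X=\overline{\bigcup_{n=0}^\infty X_n}$. *)

theory Defs
  imports "HOL-Analysis.Analysis" "HOL-Library.Omega_Words_Fun"
begin

section \<open>Omega-chaos\<close>

text \<open>
  The metric enters only through its topology: the phase space is a compact metrizable subspace of
  an ambient topological type, and limit points are taken inside it.
\<close>

definition dynamical_system :: "'a::topological_space set \<Rightarrow> ('a \<Rightarrow> 'a) \<Rightarrow> bool" where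
  "dynamical_system X T \<longleftrightarrow>
     compact X \<and> metrizable_space (top_of_set X) \<and> continuous_on X T \<and> T ` X \<subseteq> X"

definition omega_limit :: "'a::topological_space set \<Rightarrow> ('a \<Rightarrow> 'a) \<Rightarrow> 'a \<Rightarrow> 'a set" where
  "omega_limit X T x = {y \<in> X. \<exists>r. strict_mono r \<and> (\<lambda>n. (T ^^ r n) x) \<longlonglongrightarrow> y}"

definition periodic_points :: "'a set \<Rightarrow> ('a \<Rightarrow> 'a) \<Rightarrow> 'a set" where
  "periodic_points X T = {x \<in> X. \<exists>p\<ge>1. (T ^^ p) x = x}"

definition omega_chaotic :: "'a::topological_space set \<Rightarrow> ('a \<Rightarrow> 'a) \<Rightarrow> bool" where
  "omega_chaotic X T \<longleftrightarrow> dynamical_system X T \<and>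
     (\<exists>S\<subseteq>X. uncountable S \<and>
       (\<forall>x\<in>S. \<forall>y\<in>S. x \<noteq> y \<longrightarrow>
          uncountable (omega_limit X T x - omega_limit X T y) \<and>
          omega_limit X T x \<inter> omega_limit X T y \<noteq> {} \<and>
          \<not> omega_limit X T x \<subseteq> periodic_points X T))"

section \<open>Binary sequences and blocks\<close>

text \<open>
  The full shift is \<^typ>\<open>bool word\<close>, that is \<^typ>\<open>nat \<Rightarrow> bool\<close>, with the product topology of the
  discrete topology on \<^typ>\<open>bool\<close>; \<^const>\<open>True\<close> is the symbol 1 and \<^const>\<open>False\<close> the symbol 0.
  Coordinates start at 0 instead of 1. Blocks are lists; \<open>u \<frown> x\<close> and \<open>u\<^sup>\<omega>\<close> from
  \<^theory>\<open>HOL-Library.Omega_Words_Fun\<close> are the concatenation of a block with a sequence and the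
  infinite repetition of a nonempty block.
\<close>

definition shift :: "bool word \<Rightarrow> bool word" where
  "shift x = (\<lambda>i. x (Suc i))"

abbreviation zeros :: "nat \<Rightarrow> bool list" where
  "zeros k \<equiv> replicate k False"

abbreviation zero_seq :: "bool word" where
  "zero_seq \<equiv> (\<lambda>_. False)"

definition from_1_to_1 :: "bool list \<Rightarrow> bool" where
  "from_1_to_1 u \<longleftrightarrow> u = [True] \<or> (\<exists>v. u = [True] @ v @ [True])"

definition occurs_in :: "bool list \<Rightarrow> bool word \<Rightarrow> bool" where
  "occurs_in u y \<longleftrightarrow> (\<exists>i j. u = y [i \<rightarrow> j])"

definition G :: "nat \<Rightarrow> bool word set \<Rightarrow> bool list set" where
  "G m Y = {u. from_1_to_1 u \<and> (\<exists>y\<in>Y. occurs_in u y) \<and> count_list u True \<le> m}"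

section \<open>The shift space\<close>

text \<open>
  In \<open>P_step n Y\<close>, \<open>J'_step n Y\<close>, \<open>J''_step n Y\<close> and \<open>Y_step n Y\<close> the set \<open>Y\<close> plays the role of the
  \<open>n\<close>-th stage \<open>X_seq n\<close>; the results are the sets with index \<open>n + 1\<close>.
\<close>

definition P_step :: "nat \<Rightarrow> bool word set \<Rightarrow> bool word set" where
  "P_step n Y = (\<Union>l. (shift ^^ l) ` {(u @ zeros k)\<^sup>\<omega> | u k. k \<ge> 2 ^ (2 * n) \<and> u \<in> G (2 ^ n) Y})"

definition J'_step :: "nat \<Rightarrow> bool word set \<Rightarrow> bool word set" where
  "J'_step n Y = {(zeros \<alpha> @ u) \<frown> zero_seq | \<alpha> u. u \<in> G (2 ^ n) Y}"

definition J''_step :: "nat \<Rightarrow> bool word set \<Rightarrow> bool word set" where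
  "J''_step n Y = {(zeros \<alpha> @ u @ zeros \<beta> @ v) \<frown> zero_seq | \<alpha> u \<beta> v.
     \<beta> \<ge> 2 ^ (2 * n) \<and> u \<in> G (2 ^ n) Y \<and> v \<in> G (2 ^ n) Y}"

definition Y_step :: "nat \<Rightarrow> bool word set \<Rightarrow> bool word set" where
  "Y_step n Y = closure (P_step n Y \<union> (J'_step n Y \<union> J''_step n Y))"

primrec X_seq :: "nat \<Rightarrow> bool word set" where
  "X_seq 0 = {zero_seq} \<union> {(zeros \<alpha> @ [True]) \<frown> zero_seq | \<alpha>. True}"
| "X_seq (Suc n) = X_seq n \<union> Y_step n (X_seq n)"

definition X_space :: "bool word set" where
  "X_space = closure (\<Union>n. X_seq n)"

end

theory Submission
  imports Defs
begin

text \<open>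
  Fix gap lengths \<open>b n \<ge> 4\<^sup>n\<close>, strictly increasing, and let \<open>U\<^sub>0 = 1\<close>,
  \<open>U\<^sub>n\<^sub>+\<^sub>1 = U\<^sub>n 0\<^bsup>b n\<^esup> U\<^sub>n\<close>. Each \<open>U\<^sub>n\<close> is a block of the \<open>n\<close>-th stage, so the limit \<open>x\<^sub>b\<close> of the
  \<open>U\<^sub>n 0\<^sup>\<infinity>\<close> lies in the shift space. It is recurrent in a strong sense: for a binary
  sequence \<open>c\<close>, extend suffixes of \<open>U\<^sub>n\<close> to the right by \<open>0\<^bsup>b n\<^esup> U\<^sub>n\<close> whenever \<open>c n\<close> holds. The
  resulting points are pairwise distinct, they are all in the limit set of \<open>x\<^sub>b\<close>, and the one for
  \<open>c\<close> contains the gap \<open>1 0\<^bsup>b n\<^esup> 1\<close> if \<open>c n\<close> holds. Conversely, every gap of a point in the limit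
  set of \<open>x\<^sub>b\<close> has length in the range of \<open>b\<close>. With \<open>b n = 4\<^sup>n + s n\<close> for \<open>s \<in> {0,1}\<^sup>\<nat>\<close>,
  two different \<open>s\<close> are separated by some gap, which yields uncountably many points.
\<close>

section \<open>Topology of the full shift\<close>

lemma tendsto_word_iff:
  fixes f :: "'b \<Rightarrow> bool word"
  shows "(f \<longlongrightarrow> y) F \<longleftrightarrow> (\<forall>i. \<forall>\<^sub>F n in F. f n i = y i)"
proof -
  have "(f \<longlongrightarrow> y) F \<longleftrightarrow> limitin (product_topology (\<lambda>i. euclidean) UNIV) f y F"
    by (simp add: euclidean_product_topology)
  also have "\<dots> \<longleftrightarrow> (\<forall>i. \<forall>\<^sub>F n in F. f n i = y i)"
    by (simp add: limitin_componentwise tendsto_discrete)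
  finally show ?thesis .
qed

lemma compact_UNIV_word: "compact (UNIV :: bool word set)"
proof -
  have "compact_space (product_topology (\<lambda>i::nat. euclidean :: bool topology) UNIV)"
    unfolding compact_space_product_topology by (auto simp: compact_space_def finite_imp_compact)
  then show ?thesis
    by (simp add: euclidean_product_topology compact_space_def)
qed

lemma metrizable_space_word: "metrizable_space (euclidean :: bool word topology)"
proof -
  have "(euclidean :: bool topology) = discrete_topology UNIV"
    by (simp add: topology_eq open_discrete)
  then have "metrizable_space (product_topology (\<lambda>i::nat. euclidean :: bool topology) UNIV)"
    by (simp add: metrizable_space_product_topology)
  then show ?thesis
    by (simp add: euclidean_product_topology)
qed

lemma funpow_shift [simp]: "(shift ^^ n) x i = x (n + i)"
  by (induction n arbitrary: x i) (simp_all add: shift_def)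

lemma continuous_on_shift: "continuous_on A shift"
  unfolding shift_def by (intro continuous_on_coordinatewise_then_product)
    (metis continuous_on_product_coordinates continuous_on_subset subset_UNIV)

text \<open>Cantor's diagonal argument on the coordinates past \<open>n\<close>. It supplies
  uncountably many codes whose points all show the \<open>n\<close>-th gap.\<close>

lemma uncountable_fixed_coordinate: "uncountable {c :: bool word. c n}"
proof -
  have "\<not> range f = {c. c n}" for f :: "nat \<Rightarrow> bool word"
  proof
    assume f: "range f = {c. c n}"
    \<comment> \<open>Being true up to \<open>n\<close> puts \<open>d\<close> into the set; at
      coordinate \<open>k + n + 1\<close> it differs from \<open>f k\<close>.\<close>
    define d where "d m = (m \<le> n \<or> \<not> f (m - n - 1) m)" for m
    have "d \<in> range f"
      by (simp add: f d_def)
    then obtain k where "d = f k"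
      by auto
    then have "d (k + n + 1) = f k (k + n + 1)"
      by simp
    then show False
      by (simp add: d_def)
  qed
  moreover have "(\<lambda>_. True) \<in> {c :: bool word. c n}"
    by simp
  ultimately show ?thesis
    unfolding uncountable_def by blast
qed

section \<open>The space as a dynamical system\<close>

lemma from_1_to_1_iff: "from_1_to_1 u \<longleftrightarrow> u \<noteq> [] \<and> hd u \<and> last u"
proof
  assume u: "u \<noteq> [] \<and> hd u \<and> last u"
  show "from_1_to_1 u"
  proof (cases u)
    case (Cons a w)
    show ?thesis
    proof (cases w rule: rev_cases)
      case Nil
      then show ?thesis using u Cons by (simp add: from_1_to_1_def)
    next
      case (snoc w' b)
      then show ?thesis using u Cons by (simp add: from_1_to_1_def)
    qed
  qed (use u in simp)
qed (auto simp: from_1_to_1_def)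

lemma G_suffix:
  assumes "w @ u \<in> G m Y" and "u \<noteq> []" and "hd u"
  shows "u \<in> G m Y"
proof -
  obtain y i j where y: "y \<in> Y" "w @ u = subsequence y i j"
    using assms(1) by (auto simp: G_def occurs_in_def)
  have "u = drop (length w) (subsequence y i j)"
    by (simp flip: y(2))
  also have "\<dots> = subsequence y (i + length w) j"
    by (simp add: subsequence_def drop_map)
  finally show ?thesis
    using assms y(1) by (auto simp: G_def occurs_in_def from_1_to_1_iff)
qed

text \<open>Dropping the leading one exposes a run of zeros and then a suffix that starts with a one
  again. The run becomes the new leading zeros of a shifted point of \<open>J'_step\<close> or
  \<open>J''_step\<close>.\<close>

lemma G_tl:
  assumes "u \<in> G m Y" and "tl u \<noteq> []"
  obtains \<alpha> v where "tl u = zeros \<alpha> @ v" and "v \<in> G m Y"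
proof
  define z where "z = takeWhile Not (tl u)"
  define v where "v = dropWhile Not (tl u)"
  have u: "u \<noteq> []" "last u"
    using assms(1) by (auto simp: G_def from_1_to_1_iff)
  have "last (tl u)"
    using u assms(2) by (simp add: last_tl)
  then have ne: "v \<noteq> []"
    using last_in_set[OF assms(2)] unfolding v_def by (auto simp: dropWhile_eq_Nil_conv)
  have tl: "tl u = z @ v"
    by (simp add: z_def v_def)
  have "\<forall>a\<in>set z. a = False"
    by (auto simp: z_def dest: set_takeWhileD)
  then have "z = zeros (length z)"
    by (simp add: replicate_length_same)
  with tl show "tl u = zeros (length z) @ v"
    by simp
  have "u = (hd u # z) @ v"
    using u tl by (metis append_Cons list.collapse)
  moreover have "hd v"
    using hd_dropWhile[of Not "tl u"] ne by (simp add: v_def)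
  ultimately show "v \<in> G m Y"
    using assms(1) ne G_suffix by metis
qed

lemma shift_conc:
  assumes "u \<noteq> []"
  shows "shift (u \<frown> x) = tl u \<frown> x"
proof
  fix i
  show "shift (u \<frown> x) i = (tl u \<frown> x) i"
    using assms by (cases u) (auto simp: shift_def conc_def)
qed

lemma J'_I: "u \<in> G (2 ^ n) Y \<Longrightarrow> (zeros \<alpha> @ u) \<frown> zero_seq \<in> J'_step n Y"
  by (auto simp: J'_step_def)

lemma J''_I:
  "u \<in> G (2 ^ n) Y \<Longrightarrow> v \<in> G (2 ^ n) Y \<Longrightarrow> \<beta> \<ge> 2 ^ (2 * n) \<Longrightarrow>
    (zeros \<alpha> @ u @ zeros \<beta> @ v) \<frown> zero_seq \<in> J''_step n Y"
  unfolding J''_step_def by blast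

lemma G_nonempty: "u \<in> G m Y \<Longrightarrow> u \<noteq> []"
  by (auto simp: G_def from_1_to_1_iff)

text \<open>The extra point \<open>zero_seq\<close> arises when \<alpha> = 0 and
  \<open>u = [True]\<close>: the shift erases the only one.\<close>

lemma shift_J':
  assumes "x \<in> J'_step n Y"
  shows "shift x \<in> insert zero_seq (J'_step n Y)"
proof -
  obtain \<alpha> u where x: "x = (zeros \<alpha> @ u) \<frown> zero_seq" and u: "u \<in> G (2 ^ n) Y"
    using assms by (auto simp: J'_step_def)
  have sx: "shift x = tl (zeros \<alpha> @ u) \<frown> zero_seq"
    using G_nonempty[OF u] by (simp add: x shift_conc)
  show ?thesis
  proof (cases \<alpha>)
    case 0
    show ?thesis
    proof (cases "tl u = []")
      case True
      then show ?thesis using sx 0 by simp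
    next
      case False
      obtain \<gamma> v where "tl u = zeros \<gamma> @ v" "v \<in> G (2 ^ n) Y"
        using G_tl[OF u False] .
      then show ?thesis using sx 0 J'_I by simp
    qed
  next
    case (Suc \<gamma>)
    then show ?thesis using sx u J'_I by simp
  qed
qed

text \<open>If \<alpha> = 0 and \<open>u = [True]\<close>, the first word disappears and the \<beta>
  zeros lead a point of \<open>J'_step\<close>; otherwise two words remain.\<close>

lemma shift_J'':
  assumes "x \<in> J''_step n Y"
  shows "shift x \<in> J'_step n Y \<union> J''_step n Y"
proof -
  obtain \<alpha> u \<beta> v where x: "x = (zeros \<alpha> @ u @ zeros \<beta> @ v) \<frown> zero_seq"
    and uv: "u \<in> G (2 ^ n) Y" "v \<in> G (2 ^ n) Y" "\<beta> \<ge> 2 ^ (2 * n)"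
    using assms unfolding J''_step_def by blast
  have sx: "shift x = tl (zeros \<alpha> @ u @ zeros \<beta> @ v) \<frown> zero_seq"
    unfolding x using G_nonempty[OF uv(1)] by (intro shift_conc) simp
  show ?thesis
  proof (cases \<alpha>)
    case 0
    show ?thesis
    proof (cases "tl u = []")
      case True
      then have "shift x = (zeros \<beta> @ v) \<frown> zero_seq"
        using sx 0 G_nonempty[OF uv(1)] by simp
      then show ?thesis by (intro UnI1) (simp only: J'_I uv)
    next
      case False
      obtain \<gamma> w where w: "tl u = zeros \<gamma> @ w" "w \<in> G (2 ^ n) Y"
        using G_tl[OF uv(1) False] .
      then have "shift x = (zeros \<gamma> @ w @ zeros \<beta> @ v) \<frown> zero_seq"
        using sx 0 G_nonempty[OF uv(1)] by simp
      then show ?thesis by (intro UnI2) (simp only: J''_I w uv)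
    qed
  next
    case (Suc \<gamma>)
    then have "shift x = (zeros \<gamma> @ u @ zeros \<beta> @ v) \<frown> zero_seq"
      using sx by simp
    then show ?thesis by (intro UnI2) (simp only: J''_I uv)
  qed
qed

lemma shift_P:
  assumes "x \<in> P_step n Y"
  shows "shift x \<in> P_step n Y"
proof -
  obtain l w where "x = (shift ^^ l) w"
      "w \<in> {(u @ zeros k)\<^sup>\<omega> | u k. k \<ge> 2 ^ (2 * n) \<and> u \<in> G (2 ^ n) Y}"
    using assms by (auto simp: P_step_def)
  then show ?thesis
    unfolding P_step_def by (intro UN_I[of "Suc l"] image_eqI[of _ _ w]) auto
qed

lemma closed_X_space: "closed X_space"
  by (simp add: X_space_def)

lemma X_seq_subset_X_space: "X_seq n \<subseteq> X_space"
  unfolding X_space_def by (rule order_trans[OF UN_upper[OF UNIV_I] closure_subset])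

lemma zero_seq_in_X_space: "zero_seq \<in> X_space"
  by (rule subsetD[OF X_seq_subset_X_space[of 0]]) simp

lemma X_seq_0I: "(zeros \<alpha> @ [True]) \<frown> zero_seq \<in> X_seq 0"
  unfolding X_seq.simps by (intro UnI2 CollectI exI[of _ \<alpha>] conjI refl TrueI)

text \<open>The target \<open>X_space\<close> is closed and contains \<open>zero_seq\<close>, so an
  inclusion checked on the generators of a stage passes to their closure by continuity.\<close>

lemma shift_X_seq: "shift ` X_seq n \<subseteq> X_space"
proof (induction n)
  case 0
  have "shift ((zeros \<alpha> @ [True]) \<frown> zero_seq) \<in> X_seq 0" for \<alpha>
  proof -
    have eq: "shift ((zeros \<alpha> @ [True]) \<frown> zero_seq) = tl (zeros \<alpha> @ [True]) \<frown> zero_seq"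
      by (rule shift_conc) simp
    show ?thesis
    proof (cases \<alpha>)
      case 0
      then show ?thesis unfolding eq by simp
    next
      case (Suc \<gamma>)
      then have "tl (zeros \<alpha> @ [True]) = zeros \<gamma> @ [True]"
        by simp
      then show ?thesis by (simp only: eq X_seq_0I)
    qed
  qed
  moreover have "shift zero_seq = zero_seq"
    by (simp add: shift_def)
  ultimately have "shift ` X_seq 0 \<subseteq> X_seq 0"
    unfolding X_seq.simps by blast
  then show ?case
    using X_seq_subset_X_space[of 0] by blast
next
  case (Suc n)
  let ?A = "P_step n (X_seq n) \<union> (J'_step n (X_seq n) \<union> J''_step n (X_seq n))"
  have A: "?A \<subseteq> X_space"
    using X_seq_subset_X_space[of "Suc n"] closure_subset[of ?A] by (auto simp: Y_step_def)
  have "shift ` ?A \<subseteq> insert zero_seq ?A"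
    using shift_J' shift_J'' shift_P by blast
  also have "\<dots> \<subseteq> X_space"
    by (simp only: insert_subset zero_seq_in_X_space A simp_thms)
  finally have "shift ` ?A \<subseteq> X_space" .
  then have "shift ` closure ?A \<subseteq> X_space"
    by (intro image_closure_subset continuous_on_shift closed_X_space)
  with Suc show ?case
    by (simp add: Y_step_def image_Un)
qed

lemma shift_X_space: "shift ` X_space \<subseteq> X_space"
proof -
  have "shift ` (\<Union>n. X_seq n) \<subseteq> X_space"
    using shift_X_seq by blast
  then show ?thesis
    using image_closure_subset[OF continuous_on_shift closed_X_space]
    by (simp add: X_space_def)
qed

lemma funpow_shift_X_space: "x \<in> X_space \<Longrightarrow> (shift ^^ n) x \<in> X_space"
  by (induction n) (use shift_X_space in auto)

lemma dynamical_system_X_space: "dynamical_system X_space shift"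
  unfolding dynamical_system_def
proof (intro conjI shift_X_space continuous_on_shift)
  show "compact X_space"
    using compact_Int_closed[OF compact_UNIV_word closed_X_space] by simp
  show "metrizable_space (top_of_set X_space)"
    by (intro metrizable_space_subtopology metrizable_space_word)
qed

text \<open>Matching ever longer initial blocks is convergence in the product topology. One
  \<open>N\<close> bounds both the length of a match and its position, so the matches can be thinned
  to increasing times.\<close>

lemma omega_limit_X_spaceI:
  assumes x: "x \<in> X_space" and ex: "\<And>N. \<exists>i\<ge>N. \<forall>j<N. x (i + j) = y j"
  shows "y \<in> omega_limit X_space shift x"
proof -
  from ex have "\<forall>N. \<exists>i. i \<ge> N \<and> (\<forall>j<N. x (i + j) = y j)"
    by blast
  then obtain f where "\<forall>N. f N \<ge> N \<and> (\<forall>j<N. x (f N + j) = y j)"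
    by (auto dest: choice)
  then have f: "f N \<ge> N" "j < N \<Longrightarrow> x (f N + j) = y j" for N j
    by auto
  \<comment> \<open>The recursion gives \<open>r (Suc n) = f (Suc (r n)) > r n\<close>, while
    \<open>n \<le> k n\<close> makes the matched length unbounded.\<close>
  define k where "k = rec_nat 0 (\<lambda>n m. Suc (f m))"
  define r where "r n = f (k n)" for n
  have k_Suc: "k (Suc n) = Suc (r n)" for n
    by (simp add: k_def r_def)
  have k: "n \<le> k n" for n
  proof (induction n)
    case (Suc n)
    then show ?case
      using f(1)[of "k n"] by (simp add: k_Suc r_def)
  qed simp
  have "r n < r (Suc n)" for n
    using f(1)[of "k (Suc n)"] unfolding r_def[of "Suc n"] by (simp add: k_Suc)
  then have mono: "strict_mono r"
    by (simp add: strict_mono_Suc_iff)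
  have lim: "(\<lambda>n. (shift ^^ r n) x) \<longlonglongrightarrow> y"
    unfolding tendsto_word_iff
  proof
    fix i
    have "(shift ^^ r n) x i = y i" if "n \<ge> Suc i" for n
      using f(2)[of i "k n"] k[of n] that by (simp add: r_def)
    then show "\<forall>\<^sub>F n in sequentially. (shift ^^ r n) x i = y i"
      unfolding eventually_sequentially by blast
  qed
  then have "y \<in> X_space"
    by (intro Lim_in_closed_set[OF closed_X_space _ _ lim]) (use funpow_shift_X_space x in auto)
  with mono lim show ?thesis
    unfolding omega_limit_def by blast
qed

text \<open>Over a discrete alphabet, finitely many coordinates settle simultaneously; one such time
  is enough to transfer a gap.\<close>

lemma omega_limit_block:
  assumes "y \<in> omega_limit X shift x"
  shows "\<exists>i. \<forall>j<N. x (i + j) = y j"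
proof -
  obtain r where "(\<lambda>n. (shift ^^ r n) x) \<longlonglongrightarrow> y"
    using assms unfolding omega_limit_def by blast
  then have "\<forall>\<^sub>F n in sequentially. \<forall>j\<in>{..<N}. (shift ^^ r n) x j = y j"
    unfolding tendsto_word_iff by (intro eventually_ball_finite) simp_all
  then obtain n where "\<forall>j\<in>{..<N}. (shift ^^ r n) x j = y j"
    using eventually_happens'[OF sequentially_bot] by blast
  then show ?thesis
    by auto
qed

section \<open>Points with prescribed gaps\<close>

primrec doubling_block :: "(nat \<Rightarrow> nat) \<Rightarrow> nat \<Rightarrow> bool list" where
  "doubling_block b 0 = [True]"
| "doubling_block b (Suc n) = doubling_block b n @ zeros (b n) @ doubling_block b n"

text \<open>A suffix of \<open>doubling_block b n\<close>: the bit \<open>c n\<close> decides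
  whether it starts in the left copy of the next block, and so runs on through the right copy, or in
  the right copy.\<close>

primrec tail_block :: "(nat \<Rightarrow> nat) \<Rightarrow> bool word \<Rightarrow> nat \<Rightarrow> bool list" where
  "tail_block b c 0 = [True]"
| "tail_block b c (Suc n) =
    (if c n then tail_block b c n @ zeros (b n) @ doubling_block b n else tail_block b c n)"

text \<open>The limit of the tail blocks. They only grow to the right, so ones are never removed and
  the limit collects the ones of all stages.\<close>

definition tail_seq :: "(nat \<Rightarrow> nat) \<Rightarrow> bool word \<Rightarrow> bool word" where
  "tail_seq b c i \<longleftrightarrow> (\<exists>n. (tail_block b c n \<frown> zero_seq) i)"

abbreviation doubling_seq :: "(nat \<Rightarrow> nat) \<Rightarrow> bool word" where
  "doubling_seq b \<equiv> tail_seq b (\<lambda>_. True)"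

definition has_gap :: "bool word \<Rightarrow> nat \<Rightarrow> bool" where
  "has_gap x g \<longleftrightarrow> (\<exists>i. x i \<and> x (Suc (i + g)) \<and> (\<forall>j. i < j \<and> j < Suc (i + g) \<longrightarrow> \<not> x j))"

section \<open>Blocks, their suffixes and the stable prefixes of the limit\<close>

lemma doubling_block_ends [simp]:
  "doubling_block b n \<noteq> []" "hd (doubling_block b n)" "last (doubling_block b n)"
proof -
  have "doubling_block b n \<noteq> [] \<and> hd (doubling_block b n) \<and> last (doubling_block b n)"
    by (induction n) auto
  then show "doubling_block b n \<noteq> []" "hd (doubling_block b n)" "last (doubling_block b n)"
    by auto
qed

lemma tail_block_True [simp]: "tail_block b (\<lambda>_. True) n = doubling_block b n"
  by (induction n) auto

lemma tail_block_ends [simp]: "tail_block b c n \<noteq> []" "last (tail_block b c n)"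
proof -
  have "tail_block b c n \<noteq> [] \<and> last (tail_block b c n)"
    by (induction n) auto
  then show "tail_block b c n \<noteq> []" "last (tail_block b c n)"
    by auto
qed

lemma doubling_block_eq_append_tail_block: "\<exists>q. doubling_block b n = q @ tail_block b c n"
proof (induction n)
  case (Suc n)
  then obtain q where q: "doubling_block b n = q @ tail_block b c n" ..
  show ?case
  proof (cases "c n")
    case True
    then have "doubling_block b (Suc n) = q @ tail_block b c (Suc n)"
      using q by simp
    then show ?thesis ..
  next
    case False
    then have "doubling_block b (Suc n) = (doubling_block b n @ zeros (b n) @ q) @ tail_block b c (Suc n)"
      using q by simp
    then show ?thesis ..
  qed
qed simp

lemma tail_block_cong: "(\<And>m. m < n \<Longrightarrow> c m = d m) \<Longrightarrow> tail_block b c n = tail_block b d n"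
  by (induction n) auto

text \<open>An extension at a stage \<open>m \<ge> n\<close> puts \<open>b m \<ge> b n\<close> zeros
  before its first new one, so the block and the \<open>b n\<close> zeros after it are
  final.\<close>

lemma tail_block_agree:
  assumes "mono b" and "n \<le> m" and "i < length (tail_block b c n) + b n"
  shows "(tail_block b c m \<frown> zero_seq) i = (tail_block b c n \<frown> zero_seq) i"
    and "length (tail_block b c n) \<le> length (tail_block b c m)"
proof -
  have "(tail_block b c m \<frown> zero_seq) i = (tail_block b c n \<frown> zero_seq) i \<and>
      length (tail_block b c n) \<le> length (tail_block b c m)"
    using assms(2)
  proof (induction m rule: dec_induct)
    case (step m)
    have "i < length (tail_block b c m) + b m"
      using assms(3) step monoD[OF assms(1), of n m] by linarith
    then show ?case
      using step.IH by (auto simp: conc_def nth_append)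
  qed simp
  then show "(tail_block b c m \<frown> zero_seq) i = (tail_block b c n \<frown> zero_seq) i"
    "length (tail_block b c n) \<le> length (tail_block b c m)"
    by auto
qed

lemma tail_seq_eq:
  assumes "mono b" and "i < length (tail_block b c n) + b n"
  shows "tail_seq b c i = (tail_block b c n \<frown> zero_seq) i"
proof
  assume "tail_seq b c i"
  then obtain m where m: "(tail_block b c m \<frown> zero_seq) i"
    by (auto simp: tail_seq_def)
  show "(tail_block b c n \<frown> zero_seq) i"
  proof (cases "n \<le> m")
    case True
    then show ?thesis using tail_block_agree(1)[OF assms(1) True assms(2)] m by simp
  next
    case False
    \<comment> \<open>A one of the padded block lies inside the block, hence in the stable range of
      the earlier stage \<open>m\<close>.\<close>
    have "i < length (tail_block b c m) + b m"
      using m by (auto simp: conc_def split: if_splits)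
    then show ?thesis using tail_block_agree(1)[OF assms(1), of m n i c] m False by simp
  qed
qed (auto simp: tail_seq_def)

lemma tail_seq_nth:
  "mono b \<Longrightarrow> i < length (tail_block b c n) \<Longrightarrow> tail_seq b c i = tail_block b c n ! i"
  by (simp add: tail_seq_eq[of b _ c n])

section \<open>Recurrence\<close>

lemma length_doubling_block_gt: "n < length (doubling_block b n)"
proof (induction n)
  case (Suc n)
  have "length (doubling_block b n) > 0"
    by simp
  then show ?case using Suc by simp
qed simp

text \<open>The sequence starts with \<open>doubling_block b (Suc m)\<close>, whose right half
  repeats its left half.\<close>

lemma doubling_block_shifted:
  assumes "mono b" and "j < length (doubling_block b m)"
  shows "doubling_seq b (length (doubling_block b m) + b m + j) = doubling_seq b j"
proof -
  have "doubling_seq b (length (doubling_block b m) + b m + j) = doubling_block b m ! j"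
    using tail_seq_nth[OF assms(1), of _ "\<lambda>_. True" "Suc m"] assms(2)
    by (simp add: nth_append)
  then show ?thesis
    using tail_seq_nth[OF assms(1), of j "\<lambda>_. True" m] assms(2) by simp
qed

text \<open>The tail block is a suffix of \<open>doubling_block b n\<close>, and in
  \<open>doubling_seq b\<close> that block is followed by \<open>b n\<close> zeros, just as
  \<open>tail_seq b c\<close> continues at first. A later copy of this stretch gives the
  match.\<close>

lemma tail_seq_recurs:
  assumes b: "strict_mono b"
  shows "\<exists>i\<ge>N. \<forall>j<N. doubling_seq b (i + j) = tail_seq b c j"
proof -
  have mono: "mono b"
    using b by (rule strict_mono_mono)
  \<comment> \<open>Strict monotonicity gives \<open>N \<le> b n\<close>, so the coordinates below
    \<open>N\<close> are already stable at stage \<open>n\<close>.\<close>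
  define n where "n = N"
  \<comment> \<open>The copied block has stage \<open>Suc n\<close>, so that it also contains the
    \<open>b n\<close> zeros after \<open>doubling_block b n\<close>; its length exceeds
    \<open>N\<close>, which places the second copy far enough out.\<close>
  define L where "L = length (doubling_block b (Suc n))"
  obtain q where q: "doubling_block b n = q @ tail_block b c n"
    using doubling_block_eq_append_tail_block by blast
  have "N \<le> b n"
    using strict_mono_imp_increasing[OF b] by (simp add: n_def)
  have "doubling_seq b (L + b (Suc n) + length q + j) = tail_seq b c j" if "j < N" for j
  proof -
    have j: "j < length (tail_block b c n) + b n"
      using that \<open>N \<le> b n\<close> by simp
    have "doubling_seq b (L + b (Suc n) + (length q + j)) = doubling_seq b (length q + j)"
      unfolding L_def by (rule doubling_block_shifted[OF mono]) (use j q in simp)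
    also have "\<dots> = (doubling_block b n \<frown> zero_seq) (length q + j)"
      using tail_seq_eq[OF mono, of "length q + j" "\<lambda>_. True" n] j q by simp
    also have "\<dots> = (tail_block b c n \<frown> zero_seq) j"
      by (simp add: q conc_def nth_append)
    also have "\<dots> = tail_seq b c j"
      using tail_seq_eq[OF mono j] by simp
    finally show ?thesis
      by (simp add: add.assoc)
  qed
  moreover have "N \<le> L + b (Suc n) + length q"
    using length_doubling_block_gt[of "Suc n" b] by (simp add: L_def n_def)
  ultimately show ?thesis
    by blast
qed

section \<open>Gaps between consecutive ones\<close>

lemma tail_seq_at_gap_end:
  assumes "mono b" and "c n"
  shows "tail_seq b c (length (tail_block b c n) + b n)"
proof -
  have "doubling_block b n ! 0"
    using doubling_block_ends(1,2) by (metis hd_conv_nth)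
  then show ?thesis
    using assms by (simp add: tail_seq_nth[of b _ c "Suc n"] nth_append)
qed

lemma has_gap_tail_seq:
  assumes "mono b" and "c n"
  shows "has_gap (tail_seq b c) (b n)"
proof -
  define l where "l = length (tail_block b c n)"
  have l: "l > 0"
    by (simp add: l_def)
  have "tail_block b c n ! (l - 1)"
    using tail_block_ends by (metis last_conv_nth l_def)
  then have "tail_seq b c (l - 1)"
    using l assms by (simp add: tail_seq_nth[of b _ c n] l_def)
  moreover have "tail_seq b c (Suc (l - 1 + b n))"
  proof -
    have "Suc (l - 1 + b n) = l + b n"
      using l by simp
    then show ?thesis
      using tail_seq_at_gap_end[of b c n] assms by (simp only: l_def)
  qed
  moreover have "\<not> tail_seq b c j" if "l - 1 < j" "j < Suc (l - 1 + b n)" for j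
  proof -
    have "l \<le> j" "j < l + b n"
      using that l by linarith+
    then show ?thesis
      using tail_seq_eq[OF assms(1), of j c n] by (simp add: l_def)
  qed
  ultimately show ?thesis
    unfolding has_gap_def by blast
qed

text \<open>Two consecutive ones lie both in the left copy, both in the right copy, or on either
  side of the middle zeros. The first two cases are inductive, the last gives
  \<open>b n\<close>.\<close>

lemma doubling_block_gap:
  assumes "i < k" and "k < length (doubling_block b n)"
    and "doubling_block b n ! i" and "doubling_block b n ! k"
    and "\<And>j. i < j \<Longrightarrow> j < k \<Longrightarrow> \<not> doubling_block b n ! j"
  shows "\<exists>m. k = Suc (i + b m)"
  using assms
proof (induction n arbitrary: i k)
  case (Suc n)
  let ?U = "doubling_block b n"
  define l where "l = length ?U"
  have l: "l > 0"
    by (simp add: l_def)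
  have nth: "doubling_block b (Suc n) ! j =
      (if j < l then ?U ! j else l + b n \<le> j \<and> ?U ! (j - l - b n))" if "j < l + b n + l" for j
    using that by (auto simp: nth_append l_def)
  have last: "?U ! (l - 1)" and first: "?U ! 0"
    using doubling_block_ends by (metis last_conv_nth l_def, metis hd_conv_nth)
  have k: "k < l + b n + l"
    using Suc.prems(2) by (simp add: l_def)
  have i: "if i < l then ?U ! i else l + b n \<le> i \<and> ?U ! (i - l - b n)"
    using Suc.prems(1,3) k nth[of i] by simp
  have k': "if k < l then ?U ! k else l + b n \<le> k \<and> ?U ! (k - l - b n)"
    using Suc.prems(4) k nth[of k] by simp
  have gap: "\<not> (if j < l then ?U ! j else l + b n \<le> j \<and> ?U ! (j - l - b n))"
    if "i < j" "j < k" for j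
    using Suc.prems(5)[OF that] nth[of j] that k by simp
  consider "k < l" | "l \<le> i" | "i < l" "l \<le> k"
    by linarith
  then show ?case
  proof cases
    case 1
    then have "\<And>j. i < j \<Longrightarrow> j < k \<Longrightarrow> \<not> ?U ! j"
      using gap by fastforce
    then show ?thesis
      using Suc.IH[of i k] Suc.prems(1) 1 i k' by (auto simp: l_def)
  next
    case 2
    \<comment> \<open>The ones at \<open>i\<close> and \<open>k\<close> lie past the middle zeros,
      so subtracting \<open>l + b n\<close> does not truncate.\<close>
    have "\<not> ?U ! j" if "i - l - b n < j" "j < k - l - b n" for j
      using gap[of "j + l + b n"] that by simp
    moreover have "i - l - b n < k - l - b n" "k - l - b n < l"
      using 2 i k k' Suc.prems(1) by (auto split: if_splits)
    ultimately obtain m where "k - l - b n = Suc (i - l - b n + b m)"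
      using Suc.IH[of "i - l - b n" "k - l - b n"] 2 i k' Suc.prems(1)
      by (auto simp: l_def)
    then have "k = Suc (i + b m)"
      using 2 i k' by (auto split: if_splits)
    then show ?thesis ..
  next
    case 3
    \<comment> \<open>Otherwise the last one of the left copy would lie strictly between
      \<open>i\<close> and \<open>k\<close>; likewise below for the first one of the right
      copy.\<close>
    have "i = l - 1"
      using gap[of "l - 1"] 3 l last by fastforce
    moreover have "k = l + b n"
      using gap[of "l + b n"] 3 k' first by fastforce
    ultimately have "k = Suc (i + b n)"
      using l by simp
    then show ?thesis ..
  qed
qed simp

lemma has_gap_doubling_seq:
  assumes "mono b" and "has_gap (doubling_seq b) g"
  shows "g \<in> range b"
proof -
  obtain i where i: "doubling_seq b i" "doubling_seq b (Suc (i + g))"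
      "\<And>j. i < j \<Longrightarrow> j < Suc (i + g) \<Longrightarrow> \<not> doubling_seq b j"
    using assms(2) by (auto simp: has_gap_def)
  \<comment> \<open>The position of the second one also serves as the stage, since the block of
    stage \<open>n\<close> is longer than \<open>n\<close>.\<close>
  define n where "n = Suc (i + g)"
  have nth: "doubling_seq b j = doubling_block b n ! j" if "j \<le> n" for j
    using tail_seq_nth[OF assms(1), of j "\<lambda>_. True" n] that length_doubling_block_gt[of n b] by simp
  have "\<exists>m. n = Suc (i + b m)"
  proof (rule doubling_block_gap)
    show "n < length (doubling_block b n)"
      by (rule length_doubling_block_gt)
  qed (use i nth in \<open>auto simp: n_def\<close>)
  then show ?thesis
    by (auto simp: n_def)
qed

text \<open>A gap is a finite pattern, so an initial block of \<open>y\<close> containing it already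
  occurs in \<open>x\<close>.\<close>

lemma has_gap_omega_limit:
  assumes "y \<in> omega_limit X shift x" and "has_gap y g"
  shows "has_gap x g"
proof -
  obtain k where k: "y k" "y (Suc (k + g))" "\<And>j. k < j \<Longrightarrow> j < Suc (k + g) \<Longrightarrow> \<not> y j"
    using assms(2) by (auto simp: has_gap_def)
  obtain i where i: "\<And>j. j < Suc (Suc (k + g)) \<Longrightarrow> x (i + j) = y j"
    using omega_limit_block[OF assms(1)] by blast
  have "x (i + k)" "x (Suc (i + k + g))"
    using i[of k] i[of "Suc (k + g)"] k by (simp_all add: add.assoc)
  moreover have "\<not> x j" if "i + k < j" "j < Suc (i + k + g)" for j
    using i[of "j - i"] k(3)[of "j - i"] that by auto
  ultimately show ?thesis
    unfolding has_gap_def by blast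
qed

lemma inj_tail_seq:
  assumes "strict_mono b"
  shows "inj (tail_seq b)"
proof -
  have mono: "mono b"
    using assms by (rule strict_mono_mono)
  have neq: "tail_seq b c \<noteq> tail_seq b d"
    if eq: "\<And>m. m < n \<Longrightarrow> c m = d m" and n: "c n" "\<not> d n" for c d n
  proof -
    let ?i = "length (tail_block b c n) + b n"
    have same: "tail_block b c n = tail_block b d n"
      using eq by (rule tail_block_cong)
    have "tail_seq b c ?i"
      using mono n(1) by (rule tail_seq_at_gap_end)
    \<comment> \<open>With \<open>d n\<close> false the block stays the same at stage
      \<open>Suc n\<close>, but its stable zeros reach up to \<open>b (Suc n) > b n\<close>, past
      position \<open>?i\<close>.\<close>
    moreover have "\<not> tail_seq b d ?i"
      using tail_seq_eq[OF mono, of ?i d "Suc n"] same n(2) strict_monoD[OF assms, of n "Suc n"]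
      by simp
    ultimately show ?thesis
      by metis
  qed
  show ?thesis
  proof (rule injI, rule ccontr)
    fix c d
    assume eq: "tail_seq b c = tail_seq b d" and "c \<noteq> d"
    then obtain n0 where "c n0 \<noteq> d n0"
      by blast
    define n where "n = (LEAST n. c n \<noteq> d n)"
    have "c n \<noteq> d n"
      unfolding n_def using \<open>c n0 \<noteq> d n0\<close> by (rule LeastI)
    moreover have "\<And>m. m < n \<Longrightarrow> c m = d m"
      unfolding n_def using not_less_Least by blast
    ultimately show False
      using neq[of n c d] neq[of n d c] eq by auto
  qed
qed

section \<open>Membership in the space\<close>

lemma J_step_subset_X_seq:
  "J'_step n (X_seq n) \<subseteq> X_seq (Suc n)" "J''_step n (X_seq n) \<subseteq> X_seq (Suc n)"
  using closure_subset[of "P_step n (X_seq n) \<union> (J'_step n (X_seq n) \<union> J''_step n (X_seq n))"]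
  by (simp_all add: Y_step_def le_supI2 del: closure_Un)

lemma occurs_in_conc: "occurs_in u (u \<frown> x)"
  unfolding occurs_in_def by (intro exI[of _ 0] exI[of _ "length u"]) simp

lemma G_I:
  "y \<in> Y \<Longrightarrow> occurs_in u y \<Longrightarrow> count_list u True \<le> m \<Longrightarrow> from_1_to_1 u \<Longrightarrow> u \<in> G m Y"
  by (auto simp: G_def)

lemma count_list_doubling_block: "count_list (doubling_block b n) True = 2 ^ n"
proof (induction n)
  case (Suc n)
  have "count_list (zeros (b n)) True = 0"
    by (simp add: count_list_0_iff)
  with Suc show ?case
    by simp
qed simp

text \<open>\<open>J''_step\<close> joins two copies across \<open>b n \<ge> 4 ^ n\<close> zeros.
  Both the number of ones and the bound in \<open>G\<close> double at each stage.\<close>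

lemma doubling_block_in_G:
  assumes "\<And>n. 4 ^ n \<le> b n"
  shows "doubling_block b n \<in> G (2 ^ n) (X_seq n)"
proof (induction n)
  case 0
  have "[True] \<frown> zero_seq \<in> X_seq 0"
    using X_seq_0I[of 0] by (simp only: replicate_0 append_Nil)
  moreover have "from_1_to_1 [True]" "count_list [True] True \<le> 2 ^ 0"
    by (simp_all add: from_1_to_1_def)
  ultimately show ?case
    unfolding doubling_block.simps by (intro G_I[OF _ occurs_in_conc])
next
  case (Suc n)
  let ?U = "doubling_block b (Suc n)"
  have "b n \<ge> 2 ^ (2 * n)"
    using assms[of n] by (simp add: power_mult)
  then have "(zeros 0 @ ?U) \<frown> zero_seq \<in> J''_step n (X_seq n)"
    unfolding doubling_block.simps by (rule J''_I[OF Suc Suc])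
  then have "?U \<frown> zero_seq \<in> X_seq (Suc n)"
    using J_step_subset_X_seq(2) by (simp only: replicate_0 append_Nil) (rule subsetD)
  moreover have "occurs_in ?U (?U \<frown> zero_seq)"
    by (rule occurs_in_conc)
  moreover have "count_list ?U True \<le> 2 ^ Suc n"
    by (simp only: count_list_doubling_block order_refl)
  moreover have "from_1_to_1 ?U"
    unfolding from_1_to_1_iff by (simp only: doubling_block_ends simp_thms)
  ultimately show ?case
    by (rule G_I)
qed

lemma doubling_seq_in_X_space:
  assumes "mono b" and "\<And>n. 4 ^ n \<le> b n"
  shows "doubling_seq b \<in> X_space"
proof (rule Lim_in_closed_set[OF closed_X_space])
  show "\<forall>\<^sub>F n in sequentially. doubling_block b n \<frown> zero_seq \<in> X_space"
  proof (rule always_eventually, rule allI)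
    fix n
    have "(zeros 0 @ doubling_block b n) \<frown> zero_seq \<in> J'_step n (X_seq n)"
      by (rule J'_I) (rule doubling_block_in_G[OF assms(2)])
    then have "doubling_block b n \<frown> zero_seq \<in> X_seq (Suc n)"
      using J_step_subset_X_seq(1) by (simp only: replicate_0 append_Nil) (rule subsetD)
    then show "doubling_block b n \<frown> zero_seq \<in> X_space"
      by (rule subsetD[OF X_seq_subset_X_space])
  qed
  show "(\<lambda>n. doubling_block b n \<frown> zero_seq) \<longlonglongrightarrow> doubling_seq b"
    unfolding tendsto_word_iff
  proof
    fix i
    have "(doubling_block b n \<frown> zero_seq) i = doubling_seq b i" if "n \<ge> i" for n
      using tail_seq_eq[OF assms(1), of i "\<lambda>_. True" n] length_doubling_block_gt[of n b] that
      by simp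
    then show "\<forall>\<^sub>F n in sequentially. (doubling_block b n \<frown> zero_seq) i = doubling_seq b i"
      unfolding eventually_sequentially by blast
  qed
qed simp

section \<open>Omega-chaos of the space\<close>

text \<open>The summand \<open>4 ^ n\<close> meets the bound of the construction, and since
  \<open>4 ^ n + 1 < 4 ^ Suc n\<close>, a gap length determines both \<open>n\<close> and the bit,
  even across different codes.\<close>

definition code_gaps :: "bool word \<Rightarrow> nat \<Rightarrow> nat" where
  "code_gaps s n = 4 ^ n + of_bool (s n)"

lemma code_gaps_less: "m < n \<Longrightarrow> code_gaps s m < code_gaps t n"
proof -
  assume "m < n"
  then have "(4::nat) ^ Suc m \<le> 4 ^ n"
    by (intro power_increasing) auto
  moreover have "(1::nat) \<le> 4 ^ m" "of_bool (s m) \<le> (1::nat)"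
    by simp_all
  ultimately show ?thesis
    unfolding code_gaps_def power_Suc by linarith
qed

lemma strict_mono_code_gaps: "strict_mono (code_gaps s)"
  by (simp add: strict_mono_def code_gaps_less)

lemma code_gaps_in_range:
  assumes "code_gaps s n \<in> range (code_gaps t)"
  shows "s n = t n"
proof -
  obtain m where m: "code_gaps s n = code_gaps t m"
    using assms by auto
  then have "m = n"
    using code_gaps_less[of m n t s] code_gaps_less[of n m s t] by (cases m n rule: linorder_cases) auto
  with m show ?thesis
    by (simp add: code_gaps_def of_bool_eq_iff)
qed

theorem lemma14:
  shows "omega_chaotic X_space shift"
proof -
  let ?x = "\<lambda>s. doubling_seq (code_gaps s)"
  let ?\<omega> = "omega_limit X_space shift"
  note smono = strict_mono_code_gaps
  note mono = strict_mono_mono[OF strict_mono_code_gaps]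
  have x: "?x s \<in> X_space" for s
    by (intro doubling_seq_in_X_space mono) (simp add: code_gaps_def)
  have tails: "tail_seq (code_gaps s) c \<in> ?\<omega> (?x s)" for s c
    by (intro omega_limit_X_spaceI x tail_seq_recurs smono)
  \<comment> \<open>The code without any extension yields a single one followed by zeros, a
    non-periodic point common to all the limit sets.\<close>
  have single: "tail_seq (code_gaps s) (\<lambda>_. False) i \<longleftrightarrow> i = 0" for s i
  proof -
    have "tail_block b (\<lambda>_. False) n = [True]" for b n
      by (induction n) auto
    then show ?thesis
      by (simp add: tail_seq_def conc_def)
  qed
  have zero: "zero_seq \<in> ?\<omega> (?x s)" for s
  proof (rule omega_limit_X_spaceI[OF x])
    fix N
    obtain i where "i \<ge> Suc N"
        "\<forall>j<Suc N. ?x s (i + j) = tail_seq (code_gaps s) (\<lambda>_. False) j"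
      using tail_seq_recurs[OF smono] by blast
    \<comment> \<open>Starting at \<open>Suc i\<close> skips the leading one of the matched pattern
      and leaves \<open>N\<close> zeros.\<close>
    then have "Suc i \<ge> N \<and> (\<forall>j<N. ?x s (Suc i + j) = zero_seq j)"
      by (auto simp: single simp flip: add_Suc_right)
    then show "\<exists>i\<ge>N. \<forall>j<N. ?x s (i + j) = zero_seq j"
      by blast
  qed
  have nonperiodic: "\<not> ?\<omega> (?x s) \<subseteq> periodic_points X_space shift" for s
  proof
    assume "?\<omega> (?x s) \<subseteq> periodic_points X_space shift"
    then have "tail_seq (code_gaps s) (\<lambda>_. False) \<in> periodic_points X_space shift"
      using tails by (rule subsetD)
    then obtain p where p: "p \<ge> 1"
        "(shift ^^ p) (tail_seq (code_gaps s) (\<lambda>_. False)) = tail_seq (code_gaps s) (\<lambda>_. False)"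
      unfolding periodic_points_def by blast
    from fun_cong[OF p(2), of 0] p(1) show False
      by (simp add: single)
  qed
  have diff: "uncountable (?\<omega> (?x s) - ?\<omega> (?x t))" if "s \<noteq> t" for s t
  proof -
    obtain n where n: "s n \<noteq> t n"
      using \<open>s \<noteq> t\<close> by blast
    \<comment> \<open>The bit \<open>c n\<close> forces the gap \<open>code_gaps s n\<close>, which
      is no value of \<open>code_gaps t\<close> because \<open>s n \<noteq> t n\<close>.\<close>
    have notin: "tail_seq (code_gaps s) c \<notin> ?\<omega> (?x t)" if "c n" for c
    proof
      assume "tail_seq (code_gaps s) c \<in> ?\<omega> (?x t)"
      then have "has_gap (?x t) (code_gaps s n)"
        using has_gap_tail_seq[where b = "code_gaps s", OF mono, of c n, OF \<open>c n\<close>] by (rule has_gap_omega_limit)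
      then have "s n = t n"
        by (rule code_gaps_in_range[OF has_gap_doubling_seq[OF mono]])
      with n show False ..
    qed
    have "uncountable (tail_seq (code_gaps s) ` {c. c n})"
    proof
      assume "countable (tail_seq (code_gaps s) ` {c. c n})"
      then have "countable {c :: bool word. c n}"
        by (rule countable_image_inj_on[OF _ inj_on_subset[OF inj_tail_seq[OF smono] subset_UNIV]])
      with uncountable_fixed_coordinate[of n] show False ..
    qed
    moreover have "tail_seq (code_gaps s) ` {c. c n} \<subseteq> ?\<omega> (?x s) - ?\<omega> (?x t)"
      by (intro image_subsetI DiffI tails notin) simp
    ultimately show ?thesis
      using countable_subset by metis
  qed
  \<comment> \<open>Equal points would have an empty, hence countable, difference of limit
    sets.\<close>
  have "inj ?x"
  proof (rule injI, rule ccontr)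
    fix s t
    assume eq: "?x s = ?x t" and "s \<noteq> t"
    from diff[OF \<open>s \<noteq> t\<close>] show False
      by (simp add: eq)
  qed
  moreover have "uncountable (UNIV :: bool word set)"
    using uncountable_fixed_coordinate[of 0] countable_subset[OF subset_UNIV] by blast
  ultimately have "uncountable (range ?x)"
    using countable_image_inj_on[of ?x UNIV] by metis
  moreover have "range ?x \<subseteq> X_space"
    by (intro image_subsetI x)
  moreover have "uncountable (?\<omega> y - ?\<omega> z) \<and> ?\<omega> y \<inter> ?\<omega> z \<noteq> {} \<and>
      \<not> ?\<omega> y \<subseteq> periodic_points X_space shift"
    if "y \<in> range ?x" "z \<in> range ?x" "y \<noteq> z" for y z
  proof -
    obtain s t where st: "y = ?x s" "z = ?x t"
      using \<open>y \<in> range ?x\<close> \<open>z \<in> range ?x\<close> by (elim rangeE)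
    then have "s \<noteq> t"
      using \<open>y \<noteq> z\<close> by metis
    have "?\<omega> y \<inter> ?\<omega> z \<noteq> {}"
      unfolding st using IntI[OF zero zero] by (metis empty_iff)
    with diff[OF \<open>s \<noteq> t\<close>] nonperiodic show ?thesis
      unfolding st by metis
  qed
  ultimately show ?thesis
    unfolding omega_chaotic_def
    by (intro conjI dynamical_system_X_space exI[of _ "range ?x"] ballI impI) simp_all
qed

end
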